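(* Let $\mathcal K$ be a thin equipment and let $d\colon A\to M$, $l\colon B\to M$ be vertical morphisms and $J\colon A\nrightarrow B$ a horizontal morphism such that the cell $\eta$ with top $J$, left side $d$, right side $l$ and bottom $1_M$ exists. Then $\eta$ satisfies the left Beck–Chevalley condition $d^*\odot J=l^*$ if and only if the following universal property holds: for all horizontal morphisms $H\colon B\nrightarrow E$ and $K\colon M\nrightarrow N$ and every vertical morphism $g\colon E\to N$, if $J\odot H\Rightarrow_{d,g}K$ then $H\Rightarrow_{l,g}K$ (so that the first cell is the horizontal composite of $\eta$ with the second). In particular, in this case $l$ is the absolute left Kan extension of $d$ along $J$.
   Context: A thin equipment $\mathcal K$ consists of two categories on the same collection of objects: one with composition $\circ$ and identities $\mathrm{id}$, whose morphisms $f\colon A\to C$ are called vertical, and one with composition $\odot$ (written in diagrammatic order) and identities $1_A$, whose morphisms $J\colon A\nrightarrow B$ are called horizontal; together with a collection of cells. A cell has a boundary consisting of a top $J\colon A\nrightarrow B$, a bottom $K\colon C\nrightarrow D$, a left side $f\colon A\to C$ and a right side $g\colon B\to D$, and is uniquely determined by its boundary; write $J\Rightarrow_{f,g}K$ if the cell with this boundary exists. The axioms are: (i) $J\Rightarrow_{f,g}K$ and $K\Rightarrow_{h,k}L$ imply $J\Rightarrow_{h\circ f,k\circ g}L$, and $J\Rightarrow_{f,g}K$ and $H\Rightarrow_{g,l}N$ imply $J\odot H\Rightarrow_{f,l}K\odot N$; (ii) $1_A\Rightarrow_{f,f}1_C$ for all $f\colon A\to C$ and $J\Rightarrow_{\mathrm{id},\mathrm{id}}J$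 for all $J$; (iii) writing $J\le K$ for $J\Rightarrow_{\mathrm{id},\mathrm{id}}K$, if $J\le K$ and $K\le J$ then $J=K$; (iv) each vertical $f\colon A\to C$ has a companion $f_*\colon A\nrightarrow C$ with $f_*\Rightarrow_{f,\mathrm{id}_C}1_C$ and $1_A\Rightarrow_{\mathrm{id}_A,f}f_*$, and a conjoint $f^*\colon C\nrightarrow A$ with $f^*\Rightarrow_{\mathrm{id}_C,f}1_C$ and $1_A\Rightarrow_{f,\mathrm{id}_A}f^*$ (these are necessarily unique). Given $d\colon A\to M$ and $J\colon A\nrightarrow B$, a vertical morphism $l\colon B\to M$ is the left Kan extension of $d$ along $J$ if $J\Rightarrow_{d,l}1_M$ and, for all $H\colon B\nrightarrow C$ and $g\colon C\to M$, $J\odot H\Rightarrow_{d,g}1_M$ implies $H\Rightarrow_{l,g}1_M$. It is the absolute left Kan extension of $d$ along $J$ if moreover, for every vertical morphism $k\colon M\to N$, $k\circ l$ is the left Kan extension of $k\circ d$ along $J$. *)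

theory Defs
  imports Main
begin

record ('o, 'm) cat =
  Obj :: "'o set"
  Arr :: "'m set"
  Dom :: "'m \<Rightarrow> 'o"
  Cod :: "'m \<Rightarrow> 'o"
  Id :: "'o \<Rightarrow> 'm"
  Comp :: "'m \<Rightarrow> 'm \<Rightarrow> 'm"  \<comment> \<open>\<open>Comp C g f\<close> is \<open>g\<close> after \<open>f\<close>; only meaningful if \<open>Cod C f = Dom C g\<close>\<close>

definition Hom :: "('o, 'm, 'z) cat_scheme \<Rightarrow> 'o \<Rightarrow> 'o \<Rightarrow> 'm set" where
  "Hom C a b = {f \<in> Arr C. Dom C f = a \<and> Cod C f = b}"

locale category =
  fixes C :: "('o, 'm, 'z) cat_scheme"
  assumes Dom_in: "f \<in> Arr C \<Longrightarrow> Dom C f \<in> Obj C"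
    and Cod_in: "f \<in> Arr C \<Longrightarrow> Cod C f \<in> Obj C"
    and Id_in: "a \<in> Obj C \<Longrightarrow> Id C a \<in> Hom C a a"
    and Comp_in: "f \<in> Hom C a b \<Longrightarrow> g \<in> Hom C b c \<Longrightarrow> Comp C g f \<in> Hom C a c"
    and Comp_Id_right: "f \<in> Hom C a b \<Longrightarrow> Comp C f (Id C a) = f"
    and Comp_Id_left: "f \<in> Hom C a b \<Longrightarrow> Comp C (Id C b) f = f"
    and Comp_assoc: "f \<in> Hom C a b \<Longrightarrow> g \<in> Hom C b c \<Longrightarrow> h \<in> Hom C c e \<Longrightarrow>
      Comp C h (Comp C g f) = Comp C (Comp C h g) f"

text \<open>
  Since a cell is determined by its boundary, the cells are given by a predicate:
  \<open>Cell K J f g L\<close> says that the cell with top \<open>J\<close>, left side \<open>f\<close>, right side \<open>g\<close> and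
  bottom \<open>L\<close> exists, i.e. \<open>J \<Rightarrow>\<^bsub>f,g\<^esub> L\<close>.
\<close>

record ('o, 'v, 'h) equipment =
  Vert :: "('o, 'v) cat"
  Hor :: "('o, 'h) cat"
  Cell :: "'h \<Rightarrow> 'v \<Rightarrow> 'v \<Rightarrow> 'h \<Rightarrow> bool"

abbreviation VHom :: "('o, 'v, 'h, 'z) equipment_scheme \<Rightarrow> 'o \<Rightarrow> 'o \<Rightarrow> 'v set" where
  "VHom K \<equiv> Hom (Vert K)"

abbreviation HHom :: "('o, 'v, 'h, 'z) equipment_scheme \<Rightarrow> 'o \<Rightarrow> 'o \<Rightarrow> 'h set" where
  "HHom K \<equiv> Hom (Hor K)"

abbreviation vid :: "('o, 'v, 'h, 'z) equipment_scheme \<Rightarrow> 'o \<Rightarrow> 'v" where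
  "vid K \<equiv> Id (Vert K)"

abbreviation hid :: "('o, 'v, 'h, 'z) equipment_scheme \<Rightarrow> 'o \<Rightarrow> 'h" where
  "hid K \<equiv> Id (Hor K)"

abbreviation vcomp :: "('o, 'v, 'h, 'z) equipment_scheme \<Rightarrow> 'v \<Rightarrow> 'v \<Rightarrow> 'v"
    (infixl "\<bullet>\<index>" 70) where
  "g \<bullet>\<^bsub>K\<^esub> f \<equiv> Comp (Vert K) g f"

text \<open>Horizontal composition is written in diagrammatic order.\<close>

abbreviation hcomp :: "('o, 'v, 'h, 'z) equipment_scheme \<Rightarrow> 'h \<Rightarrow> 'h \<Rightarrow> 'h"
    (infixl "\<odot>\<index>" 70) where
  "J \<odot>\<^bsub>K\<^esub> H \<equiv> Comp (Hor K) H J"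

definition is_companion :: "('o, 'v, 'h, 'z) equipment_scheme \<Rightarrow> 'v \<Rightarrow> 'h \<Rightarrow> bool" where
  "is_companion K f P \<longleftrightarrow>
    (let A = Dom (Vert K) f; C = Cod (Vert K) f in
      P \<in> HHom K A C \<and>
      Cell K P f (vid K C) (hid K C) \<and> Cell K (hid K A) (vid K A) f P)"

definition is_conjoint :: "('o, 'v, 'h, 'z) equipment_scheme \<Rightarrow> 'v \<Rightarrow> 'h \<Rightarrow> bool" where
  "is_conjoint K f P \<longleftrightarrow>
    (let A = Dom (Vert K) f; C = Cod (Vert K) f in
      P \<in> HHom K C A \<and>
      Cell K P (vid K C) f (hid K C) \<and> Cell K (hid K A) f (vid K A) P)"

locale thin_equipment =
  fixes K :: "('o, 'v, 'h, 'z) equipment_scheme" (structure)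
  assumes Vert_category: "category (Vert K)"
    and Hor_category: "category (Hor K)"
    and same_Obj: "Obj (Hor K) = Obj (Vert K)"
    and Cell_boundary: "Cell K J f g L \<Longrightarrow>
      \<exists>A B C D. J \<in> HHom K A B \<and> L \<in> HHom K C D \<and> f \<in> VHom K A C \<and> g \<in> VHom K B D"
    and Cell_vcomp: "Cell K J f g L \<Longrightarrow> Cell K L h k N \<Longrightarrow> Cell K J (h \<bullet> f) (k \<bullet> g) N"
    and Cell_hcomp: "Cell K J f g L \<Longrightarrow> Cell K H g l N \<Longrightarrow> Cell K (J \<odot> H) f l (L \<odot> N)"
    and Cell_hid: "f \<in> VHom K A C \<Longrightarrow> Cell K (hid K A) f f (hid K C)"
    and Cell_vid: "J \<in> HHom K A B \<Longrightarrow> Cell K J (vid K A) (vid K B) J"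
    and Cell_antisym: "J \<in> HHom K A B \<Longrightarrow> L \<in> HHom K A B \<Longrightarrow>
      Cell K J (vid K A) (vid K B) L \<Longrightarrow> Cell K L (vid K A) (vid K B) J \<Longrightarrow> J = L"
    and ex_companion: "f \<in> Arr (Vert K) \<Longrightarrow> \<exists>P. is_companion K f P"
    and ex_conjoint: "f \<in> Arr (Vert K) \<Longrightarrow> \<exists>P. is_conjoint K f P"

text \<open>The description below is proper by \<open>ex1_conjoint\<close>.\<close>

definition conjoint :: "('o, 'v, 'h, 'z) equipment_scheme \<Rightarrow> 'v \<Rightarrow> 'h" where
  "conjoint K f = (THE P. is_conjoint K f P)"

lemma (in thin_equipment) is_conjoint_le:
  assumes "is_conjoint K f P" "is_conjoint K f Q"
  shows "Cell K P (vid K (Cod (Vert K) f)) (vid K (Dom (Vert K) f)) Q"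
proof -
  interpret H: category "Hor K" by (rule Hor_category)
  let ?A = "Dom (Vert K) f" and ?C = "Cod (Vert K) f"
  have P: "P \<in> HHom K ?C ?A" "Cell K P (vid K ?C) f (hid K ?C)"
    and Q: "Q \<in> HHom K ?C ?A" "Cell K (hid K ?A) f (vid K ?A) Q"
    using assms by (simp_all add: is_conjoint_def Let_def)
  have "Cell K (P \<odot> hid K ?A) (vid K ?C) (vid K ?A) (hid K ?C \<odot> Q)"
    by (rule Cell_hcomp[OF P(2) Q(2)])
  then show ?thesis
    by (simp add: H.Comp_Id_left[OF P(1)] H.Comp_Id_right[OF Q(1)])
qed

lemma (in thin_equipment) ex1_conjoint:
  assumes "f \<in> Arr (Vert K)"
  shows "\<exists>!P. is_conjoint K f P"
proof -
  have "P = Q" if "is_conjoint K f P" "is_conjoint K f Q" for P Q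
    using that
    by (intro Cell_antisym[OF _ _ is_conjoint_le[OF that] is_conjoint_le[OF that(2,1)]])
      (simp_all add: is_conjoint_def Let_def)
  then show ?thesis using ex_conjoint[OF assms] by blast
qed

definition left_Kan_extension ::
    "('o, 'v, 'h, 'z) equipment_scheme \<Rightarrow> 'v \<Rightarrow> 'h \<Rightarrow> 'v \<Rightarrow> bool" where
  "left_Kan_extension K d J l \<longleftrightarrow>
    (let B = Cod (Hor K) J; M = Cod (Vert K) d in
      l \<in> VHom K B M \<and> Cell K J d l (hid K M) \<and>
      (\<forall>C H g. H \<in> HHom K B C \<longrightarrow> g \<in> VHom K C M \<longrightarrow>
        Cell K (J \<odot>\<^bsub>K\<^esub> H) d g (hid K M) \<longrightarrow> Cell K H l g (hid K M)))"

definition absolute_left_Kan_extension ::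
    "('o, 'v, 'h, 'z) equipment_scheme \<Rightarrow> 'v \<Rightarrow> 'h \<Rightarrow> 'v \<Rightarrow> bool" where
  "absolute_left_Kan_extension K d J l \<longleftrightarrow>
    left_Kan_extension K d J l \<and>
    (\<forall>N k. k \<in> VHom K (Cod (Vert K) d) N \<longrightarrow>
      left_Kan_extension K (k \<bullet>\<^bsub>K\<^esub> d) J (k \<bullet>\<^bsub>K\<^esub> l))"

end

theory Submission
  imports Defs
begin

text \<open>
  The conjoint \<open>f\<^sup>*\<close> represents bending the left side of a cell up into its top: the cell with
  top \<open>H\<close>, left side \<open>f\<close> exists precisely if the one with top \<open>f\<^sup>* \<odot> H\<close> and an identity on the left
  does (\<open>Cell_bend_left\<close>). Applied to both cells in the universal property, this turns it into:
  every cell \<open>(d\<^sup>* \<odot> J) \<odot> H \<Rightarrow>\<^bsub>id,g\<^esub> K\<close> gives a cell \<open>l\<^sup>* \<odot> H \<Rightarrow>\<^bsub>id,g\<^esub> K\<close>. This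
  is trivial if \<open>d\<^sup>* \<odot> J = l\<^sup>*\<close>. Conversely, by the Yoneda argument (\<open>H\<close> and \<open>g\<close> identities,
  \<open>K = d\<^sup>* \<odot> J\<close>) it yields \<open>l\<^sup>* \<le> d\<^sup>* \<odot> J\<close>, while the opposite inequality is \<open>\<eta>\<close> itself with
  both its sides bent. By antisymmetry the two are equal.

  Being a left Kan extension is the universal property restricted to \<open>K = 1\<close>. For
  absoluteness one has to treat left sides of the form \<open>k \<bullet> d\<close>; these are absorbed by the
  companion \<open>k\<^sub>*\<close> in the bottom (\<open>Cell_bend_companion\<close>), so that it is the instance \<open>K = k\<^sub>*\<close>
  that shows \<open>k \<bullet> l\<close> to be a left Kan extension of \<open>k \<bullet> d\<close>.
\<close>

context thin_equipment
begin

interpretation V: category "Vert K" by (rule Vert_category)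
interpretation H: category "Hor K" by (rule Hor_category)

lemma hid_in:
  assumes "f \<in> VHom K A C"
  shows "hid K A \<in> HHom K A A" "hid K C \<in> HHom K C C"
  using assms V.Dom_in V.Cod_in H.Id_in same_Obj by (auto simp: Hom_def)

lemma vid_in:
  assumes "J \<in> HHom K A B"
  shows "vid K A \<in> VHom K A A" "vid K B \<in> VHom K B B"
  using assms H.Dom_in H.Cod_in V.Id_in same_Obj by (auto simp: Hom_def)

lemma is_conjoint_conjoint:
  assumes "f \<in> VHom K A C"
  shows "is_conjoint K f (conjoint K f)"
  unfolding conjoint_def
  by (rule theI'[OF ex1_conjoint]) (use assms in \<open>simp add: Hom_def\<close>)

lemma
  assumes "f \<in> VHom K A C"
  shows conjoint_in: "conjoint K f \<in> HHom K C A"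
    and conjoint_counit: "Cell K (conjoint K f) (vid K C) f (hid K C)"
    and conjoint_unit: "Cell K (hid K A) f (vid K A) (conjoint K f)"
  using is_conjoint_conjoint[OF assms] assms
  by (simp_all add: is_conjoint_def Let_def Hom_def)

lemma obtain_companion:
  assumes "f \<in> VHom K A C"
  obtains P where "P \<in> HHom K A C" "Cell K P f (vid K C) (hid K C)"
    "Cell K (hid K A) (vid K A) f P"
  using ex_companion[of f] assms by (auto simp: is_companion_def Let_def Hom_def)

text \<open>
  One direction pastes the counit of the conjoint onto the left of the cell, the other pastes
  the unit, next to the identity cell of \<open>J\<close>, on top of it.
\<close>

lemma Cell_bend_left:
  assumes f: "f \<in> VHom K A C" and J: "J \<in> HHom K A B" and L: "L \<in> HHom K C D"
    and g: "g \<in> VHom K B D"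
  shows "Cell K J f g L \<longleftrightarrow> Cell K (conjoint K f \<odot> J) (vid K C) g L"
proof
  assume "Cell K J f g L"
  from Cell_hcomp[OF conjoint_counit[OF f] this]
  show "Cell K (conjoint K f \<odot> J) (vid K C) g L"
    by (simp add: H.Comp_Id_right[OF L])
next
  assume *: "Cell K (conjoint K f \<odot> J) (vid K C) g L"
  have "Cell K (hid K A \<odot> J) f (vid K B) (conjoint K f \<odot> J)"
    by (rule Cell_hcomp[OF conjoint_unit[OF f] Cell_vid[OF J]])
  from Cell_vcomp[OF this *] show "Cell K J f g L"
    by (simp add: H.Comp_Id_right[OF J] V.Comp_Id_left[OF f] V.Comp_Id_right[OF g])
qed

text \<open>
  A right side bends down into the bottom: pasting the unit of its conjoint onto the right of
  the cell replaces the side by an identity.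
\<close>

lemma Cell_bend_right:
  assumes g: "g \<in> VHom K B M" and J: "J \<in> HHom K A B"
    and cell: "Cell K J f g (hid K M)"
  shows "Cell K J f (vid K B) (conjoint K g)"
  using Cell_hcomp[OF cell conjoint_unit[OF g]]
  by (simp add: H.Comp_Id_left[OF J] H.Comp_Id_right[OF conjoint_in[OF g]])

text \<open>
  A companion \<open>P\<close> of \<open>k\<close> in the bottom represents postcomposition of the left side with \<open>k\<close>:
  one of its two defining cells absorbs \<open>k\<close> into the bottom, the other restores it.
\<close>

lemma Cell_bend_companion:
  assumes f: "f \<in> VHom K A M" and k: "k \<in> VHom K M N"
    and J: "J \<in> HHom K A B" and g: "g \<in> VHom K B N"
    and P: "P \<in> HHom K M N" "Cell K P k (vid K N) (hid K N)" "Cell K (hid K M) (vid K M) k P"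
  shows "Cell K J (k \<bullet> f) g (hid K N) \<longleftrightarrow> Cell K J f g P"
proof
  assume *: "Cell K J (k \<bullet> f) g (hid K N)"
  have "Cell K (hid K A) (vid K M \<bullet> f) (k \<bullet> f) P"
    by (rule Cell_vcomp[OF Cell_hid[OF f] P(3)])
  from Cell_hcomp[OF this *] show "Cell K J f g P"
    by (simp add: V.Comp_Id_left[OF f] H.Comp_Id_right[OF J] H.Comp_Id_left[OF P(1)])
next
  assume "Cell K J f g P"
  from Cell_vcomp[OF this P(2)] show "Cell K J (k \<bullet> f) g (hid K N)"
    by (simp add: V.Comp_Id_left[OF g])
qed

text \<open>
  This half of the Beck--Chevalley equality holds for every \<open>\<eta>\<close>: it is \<open>\<eta>\<close> with its left side
  bent up and its right side bent down.
\<close>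

lemma conjoint_hcomp_le:
  assumes d: "d \<in> VHom K A M" and l: "l \<in> VHom K B M" and J: "J \<in> HHom K A B"
    and cell: "Cell K J d l (hid K M)"
  shows "Cell K (conjoint K d \<odot> J) (vid K M) (vid K B) (conjoint K l)"
proof (rule Cell_bend_right[OF l H.Comp_in[OF conjoint_in[OF d] J]])
  show "Cell K (conjoint K d \<odot> J) (vid K M) l (hid K M)"
    using cell Cell_bend_left[OF d J hid_in(2)[OF d] l] by simp
qed

text \<open>
  Once the left sides are bent into the tops, the universal property says that, with
  \<open>(_ \<odot> H)\<close> applied, \<open>d\<^sup>* \<odot> J\<close> may be replaced by \<open>l\<^sup>*\<close> in the top of a cell with an identity
  on the left. Testing this on the identity cell of \<open>d\<^sup>* \<odot> J\<close> gives the inequality opposite to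
  \<open>conjoint_hcomp_le\<close>.
\<close>

lemma Beck_Chevalley_iff_universal:
  assumes d: "d \<in> VHom K A M" and l: "l \<in> VHom K B M" and J: "J \<in> HHom K A B"
    and cell: "Cell K J d l (hid K M)"
  shows "conjoint K d \<odot> J = conjoint K l \<longleftrightarrow>
    (\<forall>E N H L g. H \<in> HHom K B E \<longrightarrow> L \<in> HHom K M N \<longrightarrow> g \<in> VHom K E N \<longrightarrow>
      Cell K (J \<odot> H) d g L \<longrightarrow> Cell K H l g L)"
    (is "?BC \<longleftrightarrow> ?univ")
proof -
  have dJ: "conjoint K d \<odot> J \<in> HHom K M B"
    by (rule H.Comp_in[OF conjoint_in[OF d] J])
  have bend_d: "Cell K (J \<odot> H) d g L \<longleftrightarrow> Cell K ((conjoint K d \<odot> J) \<odot> H) (vid K M) g L"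
    if "H \<in> HHom K B E" "L \<in> HHom K M N" "g \<in> VHom K E N" for E N H L g
    using Cell_bend_left[OF d H.Comp_in[OF J that(1)] that(2,3)]
    by (simp add: H.Comp_assoc[OF conjoint_in[OF d] J that(1)])
  show ?thesis
  proof
    assume ?BC
    then show ?univ
      using bend_d Cell_bend_left[OF l] by metis
  next
    assume univ: ?univ
    note B = hid_in(1)[OF l] vid_in(2)[OF J]
    have "Cell K (J \<odot> hid K B) d (vid K B) (conjoint K d \<odot> J)"
      using bend_d[OF B(1) dJ B(2)] Cell_vid[OF dJ] by (simp add: H.Comp_Id_left[OF dJ])
    with univ B dJ have "Cell K (hid K B) l (vid K B) (conjoint K d \<odot> J)"
      by blast
    then have "Cell K (conjoint K l) (vid K M) (vid K B) (conjoint K d \<odot> J)"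
      using Cell_bend_left[OF l B(1) dJ B(2)]
      by (simp add: H.Comp_Id_left[OF conjoint_in[OF l]])
    with conjoint_hcomp_le[OF d l J cell] show ?BC
      by (rule Cell_antisym[OF dJ conjoint_in[OF l]])
  qed
qed

text \<open>
  Both the Kan extension \<open>l\<close> and all its composites \<open>k \<bullet> l\<close> come from the same universal
  property: for the former take \<open>L = 1\<^sub>M\<close>, for the latter take \<open>L = k\<^sub>*\<close> and trade it for \<open>k\<close>.
\<close>

lemma absolute_left_Kan_extensionI:
  assumes d: "d \<in> VHom K A M" and l: "l \<in> VHom K B M" and J: "J \<in> HHom K A B"
    and cell: "Cell K J d l (hid K M)"
    and univ: "\<And>E N H L g. H \<in> HHom K B E \<Longrightarrow> L \<in> HHom K M N \<Longrightarrow> g \<in> VHom K E N \<Longrightarrow>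
      Cell K (J \<odot> H) d g L \<Longrightarrow> Cell K H l g L"
  shows "absolute_left_Kan_extension K d J l"
proof -
  have cods: "Cod (Hor K) J = B" "Cod (Vert K) d = M"
    using J d by (simp_all add: Hom_def)
  have "left_Kan_extension K d J l"
    unfolding left_Kan_extension_def Let_def cods
    using l cell univ hid_in(2)[OF d] by blast
  moreover have "left_Kan_extension K (k \<bullet> d) J (k \<bullet> l)" if k: "k \<in> VHom K M N" for N k
  proof -
    have codkd: "Cod (Vert K) (k \<bullet> d) = N"
      using V.Comp_in[OF d k] by (simp add: Hom_def)
    obtain P where P: "P \<in> HHom K M N" "Cell K P k (vid K N) (hid K N)"
        "Cell K (hid K M) (vid K M) k P"
      using obtain_companion[OF k] .
    have "Cell K H (k \<bullet> l) g (hid K N)"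
      if H: "H \<in> HHom K B C" and g: "g \<in> VHom K C N"
        and *: "Cell K (J \<odot> H) (k \<bullet> d) g (hid K N)" for C H g
    proof -
      have "Cell K (J \<odot> H) d g P"
        using * Cell_bend_companion[OF d k H.Comp_in[OF J H] g P] by simp
      then have "Cell K H l g P"
        by (rule univ[OF H P(1) g])
      then show ?thesis
        using Cell_bend_companion[OF l k H g P] by simp
    qed
    then show ?thesis
      unfolding left_Kan_extension_def Let_def cods codkd
      using V.Comp_in[OF l k] Cell_vcomp[OF cell Cell_hid[OF k]] by blast
  qed
  ultimately show ?thesis
    unfolding absolute_left_Kan_extension_def cods by blast
qed

end

theorem theorem2p6:
  fixes \<K> :: "('o, 'v, 'h) equipment"
  assumes "thin_equipment \<K>"
    and "d \<in> VHom \<K> A M" and "l \<in> VHom \<K> B M" and "J \<in> HHom \<K> A B"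
    and "Cell \<K> J d l (hid \<K> M)"
  shows "(conjoint \<K> d \<odot>\<^bsub>\<K>\<^esub> J = conjoint \<K> l \<longleftrightarrow>
      (\<forall>E N H K g. H \<in> HHom \<K> B E \<longrightarrow> K \<in> HHom \<K> M N \<longrightarrow> g \<in> VHom \<K> E N \<longrightarrow>
        Cell \<K> (J \<odot>\<^bsub>\<K>\<^esub> H) d g K \<longrightarrow> Cell \<K> H l g K))
    \<and> (conjoint \<K> d \<odot>\<^bsub>\<K>\<^esub> J = conjoint \<K> l \<longrightarrow> absolute_left_Kan_extension \<K> d J l)"
proof -
  interpret thin_equipment \<K> by (rule assms(1))
  note BC = Beck_Chevalley_iff_universal[OF assms(2-5)]
  have "absolute_left_Kan_extension \<K> d J l"
    if "conjoint \<K> d \<odot>\<^bsub>\<K>\<^esub> J = conjoint \<K> l"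
    by (rule absolute_left_Kan_extensionI[OF assms(2-5)]) (use that BC in blast)
  with BC show ?thesis by blast
qed

end
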